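(* Let $A$ be a finite-dimensional Hopf algebra over a field and let $B\subseteq A$ be a Hopf subalgebra. If the ring extension $A\,|\,B$ is H-separable, then $B$ is a normal Hopf subalgebra of $A$.
   Context: A ring extension $A\,|\,B$ is H-separable if the $A$-$A$-bimodule $A\otimes_BA$ is isomorphic to a direct summand of a finite direct sum $\oplus^n\,{}_AA_A$ of copies of the natural $A$-$A$-bimodule $A$. A Hopf subalgebra $B$ of a Hopf algebra $A$ (with comultiplication $\Delta(a)=a_{(1)}\otimes a_{(2)}$, counit $\varepsilon$ and antipode $\tau$) is a subalgebra that is a Hopf algebra in its own right with respect to the Hopf algebra structure of $A$ (including the antipode). It is normal if $\tau(a_{(1)})Ba_{(2)}\subseteq B$ and $a_{(1)}B\tau(a_{(2)})\subseteq B$ for all $a\in A$, i.e. $\tau(a_{(1)})\,b\,a_{(2)}\in B$ and $a_{(1)}\,b\,\tau(a_{(2)})\in B$ for all $a\in A$, $b\in B$ (Sweedler summation understood). *)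

theory Defs
  imports Complex_Main "HOL-Library.Multiset"
begin

section \<open>Tensor products\<close>

text \<open>
  The multiset \<open>{#(x\<^sub>1, y\<^sub>1), \<dots>, (x\<^sub>n, y\<^sub>n)#}\<close> stands for the finite sum of the simple tensors
  \<open>x\<^sub>i \<otimes> y\<^sub>i\<close>. The tensor product of a right \<open>S\<close>-module and a left \<open>S\<close>-module is the quotient of the
  free commutative monoid of all such formal sums by the congruence below; it is a group,
  the inverse of \<open>x \<otimes> y\<close> being \<open>(- x) \<otimes> y\<close>.
\<close>

inductive tensor_eq ::
  "'s set \<Rightarrow> ('m::ab_group_add \<Rightarrow> 's \<Rightarrow> 'm) \<Rightarrow> ('s \<Rightarrow> 'n::ab_group_add \<Rightarrow> 'n) \<Rightarrow>
    ('m \<times> 'n) multiset \<Rightarrow> ('m \<times> 'n) multiset \<Rightarrow> bool"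
  for S :: "'s set" and ract :: "'m \<Rightarrow> 's \<Rightarrow> 'm" and lact :: "'s \<Rightarrow> 'n \<Rightarrow> 'n"
where
  refl: "tensor_eq S ract lact u u"
| sym: "tensor_eq S ract lact u v \<Longrightarrow> tensor_eq S ract lact v u"
| trans: "tensor_eq S ract lact u v \<Longrightarrow> tensor_eq S ract lact v w \<Longrightarrow> tensor_eq S ract lact u w"
| cong: "tensor_eq S ract lact u v \<Longrightarrow> tensor_eq S ract lact (u + w) (v + w)"
| zero_left: "tensor_eq S ract lact {#(0, y)#} {#}"
| zero_right: "tensor_eq S ract lact {#(x, 0)#} {#}"
| add_left: "tensor_eq S ract lact {#(x + x', y)#} {#(x, y), (x', y)#}"
| add_right: "tensor_eq S ract lact {#(x, y + y')#} {#(x, y), (x, y')#}"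
| balanced: "s \<in> S \<Longrightarrow> tensor_eq S ract lact {#(ract x s, y)#} {#(x, lact s y)#}"

definition tensor_class ::
  "'s set \<Rightarrow> ('m::ab_group_add \<Rightarrow> 's \<Rightarrow> 'm) \<Rightarrow> ('s \<Rightarrow> 'n::ab_group_add \<Rightarrow> 'n) \<Rightarrow>
    ('m \<times> 'n) multiset \<Rightarrow> ('m \<times> 'n) multiset set"
  where "tensor_class S ract lact u = {v. tensor_eq S ract lact u v}"

abbreviation ktensor ::
  "('k::field \<Rightarrow> 'a::ab_group_add \<Rightarrow> 'a) \<Rightarrow> ('a \<times> 'a) multiset \<Rightarrow> ('a \<times> 'a) multiset set"
  where "ktensor scale \<equiv> tensor_class UNIV (\<lambda>x c. scale c x) scale"

text \<open>The threefold tensor power over the ground field, built from formal sums of triples.\<close>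

inductive ktensor3_eq ::
  "('k::field \<Rightarrow> 'a::ab_group_add \<Rightarrow> 'a) \<Rightarrow>
    ('a \<times> 'a \<times> 'a) multiset \<Rightarrow> ('a \<times> 'a \<times> 'a) multiset \<Rightarrow> bool"
  for scale :: "'k \<Rightarrow> 'a \<Rightarrow> 'a"
where
  refl: "ktensor3_eq scale u u"
| sym: "ktensor3_eq scale u v \<Longrightarrow> ktensor3_eq scale v u"
| trans: "ktensor3_eq scale u v \<Longrightarrow> ktensor3_eq scale v w \<Longrightarrow> ktensor3_eq scale u w"
| cong: "ktensor3_eq scale u v \<Longrightarrow> ktensor3_eq scale (u + w) (v + w)"
| zero1: "ktensor3_eq scale {#(0, y, z)#} {#}"
| zero2: "ktensor3_eq scale {#(x, 0, z)#} {#}"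
| zero3: "ktensor3_eq scale {#(x, y, 0)#} {#}"
| add1: "ktensor3_eq scale {#(x + x', y, z)#} {#(x, y, z), (x', y, z)#}"
| add2: "ktensor3_eq scale {#(x, y + y', z)#} {#(x, y, z), (x, y', z)#}"
| add3: "ktensor3_eq scale {#(x, y, z + z')#} {#(x, y, z), (x, y, z')#}"
| balanced12: "ktensor3_eq scale {#(scale c x, y, z)#} {#(x, scale c y, z)#}"
| balanced23: "ktensor3_eq scale {#(x, scale c y, z)#} {#(x, y, scale c z)#}"

definition rep :: "'b set \<Rightarrow> 'b"
  where "rep X = (SOME u. u \<in> X)"

text \<open>
  \<open>sweedler \<Delta> a f\<close> is the Sweedler sum \<open>f a\<^sub>1 a\<^sub>2\<close>, where \<open>\<Delta> a = a\<^sub>1 \<otimes> a\<^sub>2\<close>. It is computed on an arbitrary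
  representative of \<open>\<Delta> a\<close>, so it is meaningful when \<open>f\<close> is balanced biadditive, see
  \<open>sum_mset_tensor_eq\<close> (in multiset-valued uses, when \<open>f\<close> is so up to the tensor congruence).
\<close>

definition sweedler ::
  "('a \<Rightarrow> ('a \<times> 'a) multiset set) \<Rightarrow> 'a \<Rightarrow> ('a \<Rightarrow> 'a \<Rightarrow> 'c::comm_monoid_add) \<Rightarrow> 'c"
  where "sweedler \<Delta> a f = (\<Sum>(x, y) \<in># rep (\<Delta> a). f x y)"

lemma sum_mset_tensor_eq:
  fixes f :: "'m::ab_group_add \<Rightarrow> 'n::ab_group_add \<Rightarrow> 'c::ab_group_add"
  assumes "tensor_eq S ract lact u v"
    and addl: "\<And>x x' y. f (x + x') y = f x y + f x' y"
    and addr: "\<And>x y y'. f x (y + y') = f x y + f x y'"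
    and bal: "\<And>x s y. s \<in> S \<Longrightarrow> f (ract x s) y = f x (lact s y)"
  shows "(\<Sum>(x, y) \<in># u. f x y) = (\<Sum>(x, y) \<in># v. f x y)"
  using assms(1)
proof induction
  case (zero_left y)
  show ?case using addl[of 0 0 y] by simp
next
  case (zero_right x)
  show ?case using addr[of x 0 0] by simp
qed (simp_all add: addl addr bal)


section \<open>Hopf algebras\<close>

locale hopf_algebra = vector_space scale
  for scale :: "'k::field \<Rightarrow> 'a::ring_1 \<Rightarrow> 'a" +
  fixes \<Delta> :: "'a \<Rightarrow> ('a \<times> 'a) multiset set"
    and \<epsilon> :: "'a \<Rightarrow> 'k"
    and \<tau> :: "'a \<Rightarrow> 'a"
  assumes scale_mult_left: "scale c x * y = scale c (x * y)"
    and scale_mult_right: "x * scale c y = scale c (x * y)"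
    and comult_in_tensor: "\<Delta> x \<in> range (ktensor scale)"
    and comult_add: "\<Delta> (x + y) = ktensor scale (rep (\<Delta> x) + rep (\<Delta> y))"
    and comult_scale:
      "\<Delta> (scale c x) = ktensor scale (sweedler \<Delta> x (\<lambda>x1 x2. {#(scale c x1, x2)#}))"
    and comult_one: "\<Delta> 1 = ktensor scale {#(1, 1)#}"
    and comult_mult: "\<Delta> (x * y) =
      ktensor scale (sweedler \<Delta> x (\<lambda>x1 x2. sweedler \<Delta> y (\<lambda>y1 y2. {#(x1 * y1, x2 * y2)#})))"
    and coassoc: "ktensor3_eq scale
      (sweedler \<Delta> x (\<lambda>x1 x2. sweedler \<Delta> x1 (\<lambda>x11 x12. {#(x11, x12, x2)#})))
      (sweedler \<Delta> x (\<lambda>x1 x2. sweedler \<Delta> x2 (\<lambda>x21 x22. {#(x1, x21, x22)#})))"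
    and counit_linear: "Vector_Spaces.linear scale (*) \<epsilon>"
    and counit_one: "\<epsilon> 1 = 1"
    and counit_mult: "\<epsilon> (x * y) = \<epsilon> x * \<epsilon> y"
    and counit_left: "sweedler \<Delta> x (\<lambda>x1 x2. scale (\<epsilon> x1) x2) = x"
    and counit_right: "sweedler \<Delta> x (\<lambda>x1 x2. scale (\<epsilon> x2) x1) = x"
    and antipode_linear: "Vector_Spaces.linear scale scale \<tau>"
    and antipode_left: "sweedler \<Delta> x (\<lambda>x1 x2. \<tau> x1 * x2) = scale (\<epsilon> x) 1"
    and antipode_right: "sweedler \<Delta> x (\<lambda>x1 x2. x1 * \<tau> x2) = scale (\<epsilon> x) 1"

text \<open>
  Since \<open>B \<otimes> B\<close> embeds into \<open>A \<otimes> A\<close> over a field, \<open>\<Delta>\<close> restricts to \<open>B\<close> iff every \<open>\<Delta> b\<close> is a sum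
  of simple tensors with entries in \<open>B\<close>.
\<close>

definition hopf_subalgebra ::
  "('k::field \<Rightarrow> 'a::ring_1 \<Rightarrow> 'a) \<Rightarrow> ('a \<Rightarrow> ('a \<times> 'a) multiset set) \<Rightarrow> ('a \<Rightarrow> 'a) \<Rightarrow> 'a set \<Rightarrow> bool"
  where "hopf_subalgebra scale \<Delta> \<tau> B \<longleftrightarrow>
    module.subspace scale B \<and> 1 \<in> B \<and> (\<forall>x\<in>B. \<forall>y\<in>B. x * y \<in> B) \<and>
    (\<forall>b\<in>B. \<exists>u. set_mset u \<subseteq> B \<times> B \<and> \<Delta> b = ktensor scale u) \<and>
    (\<forall>b\<in>B. \<tau> b \<in> B)"

definition normal_hopf_subalgebra ::
  "('k::field \<Rightarrow> 'a::ring_1 \<Rightarrow> 'a) \<Rightarrow> ('a \<Rightarrow> ('a \<times> 'a) multiset set) \<Rightarrow> ('a \<Rightarrow> 'a) \<Rightarrow> 'a set \<Rightarrow> bool"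
  where "normal_hopf_subalgebra scale \<Delta> \<tau> B \<longleftrightarrow>
    hopf_subalgebra scale \<Delta> \<tau> B \<and>
    (\<forall>a. \<forall>b\<in>B. sweedler \<Delta> a (\<lambda>a1 a2. \<tau> a1 * b * a2) \<in> B \<and>
               sweedler \<Delta> a (\<lambda>a1 a2. a1 * b * \<tau> a2) \<in> B)"


section \<open>Bimodules and H-separable extensions\<close>

record ('a, 'm) bimodule =
  bcarrier :: "'m set"
  badd :: "'m \<Rightarrow> 'm \<Rightarrow> 'm"
  blact :: "'a \<Rightarrow> 'm \<Rightarrow> 'm"
  bract :: "'m \<Rightarrow> 'a \<Rightarrow> 'm"

text \<open>Closure under zero and negation follows by acting with \<open>0\<close> and \<open>- 1\<close>.\<close>

definition sub_bimodule :: "'m set \<Rightarrow> ('a, 'm) bimodule \<Rightarrow> bool"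
  where "sub_bimodule N M \<longleftrightarrow>
    N \<subseteq> bcarrier M \<and> N \<noteq> {} \<and>
    (\<forall>x\<in>N. \<forall>y\<in>N. badd M x y \<in> N) \<and>
    (\<forall>a. \<forall>x\<in>N. blact M a x \<in> N \<and> bract M x a \<in> N)"

definition direct_summand :: "'m set \<Rightarrow> ('a, 'm) bimodule \<Rightarrow> bool"
  where "direct_summand N M \<longleftrightarrow>
    sub_bimodule N M \<and>
    (\<exists>N'. sub_bimodule N' M \<and>
      (\<forall>m\<in>bcarrier M. \<exists>!p. p \<in> N \<times> N' \<and> badd M (fst p) (snd p) = m))"

definition bimodule_iso :: "('m \<Rightarrow> 'n) \<Rightarrow> ('a, 'm) bimodule \<Rightarrow> ('a, 'n) bimodule \<Rightarrow> bool"
  where "bimodule_iso f M N \<longleftrightarrow>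
    bij_betw f (bcarrier M) (bcarrier N) \<and>
    (\<forall>x\<in>bcarrier M. \<forall>y\<in>bcarrier M. f (badd M x y) = badd N (f x) (f y)) \<and>
    (\<forall>a. \<forall>x\<in>bcarrier M. f (blact M a x) = blact N a (f x) \<and> f (bract M x a) = bract N (f x) a)"

definition power_bimodule :: "nat \<Rightarrow> ('a::ring_1, nat \<Rightarrow> 'a) bimodule"
  where "power_bimodule n =
    \<lparr>bcarrier = {f. \<forall>i\<ge>n. f i = 0},
     badd = (\<lambda>f g i. f i + g i),
     blact = (\<lambda>a f i. a * f i),
     bract = (\<lambda>f a i. f i * a)\<rparr>"

abbreviation tensor_over :: "'a::ring_1 set \<Rightarrow> ('a \<times> 'a) multiset \<Rightarrow> ('a \<times> 'a) multiset set"
  where "tensor_over B \<equiv> tensor_class B (*) (*)"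

definition tensor_bimodule :: "'a::ring_1 set \<Rightarrow> ('a, ('a \<times> 'a) multiset set) bimodule"
  where "tensor_bimodule B =
    \<lparr>bcarrier = range (tensor_over B),
     badd = (\<lambda>X Y. tensor_over B (rep X + rep Y)),
     blact = (\<lambda>a X. tensor_over B {#(a * x, y). (x, y) \<in># rep X#}),
     bract = (\<lambda>X a. tensor_over B {#(x, y * a). (x, y) \<in># rep X#})\<rparr>"

text \<open>\<open>B\<close> is meant to be a unital subring of the ring \<open>'a\<close>.\<close>

definition h_separable :: "'a::ring_1 set \<Rightarrow> bool"
  where "h_separable B \<longleftrightarrow>
    (\<exists>n N f. direct_summand N (power_bimodule n) \<and>
      bimodule_iso f (tensor_bimodule B) ((power_bimodule n)\<lparr>bcarrier := N\<rparr>))"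

end

theory Submission
  imports Defs
begin

text \<open>
  Write \<open>A\<close> for the whole Hopf algebra. The extension turns out to be trivial: H-separability forces
  \<open>B = A\<close>, and \<open>A\<close> is normal in itself. The argument follows one element, a left integral of \<open>B\<close>,
  that is, a nonzero \<open>\<Lambda> \<in> B\<close> with \<open>b \<Lambda> = \<epsilon>(b) \<Lambda>\<close> for all \<open>b \<in> B\<close>.

  Such a \<open>\<Lambda>\<close> exists because \<open>B\<close> is finite-dimensional (\<open>integral_exists\<close>). With dual bases
  \<open>e, e\<^sup>*\<close> of \<open>B\<close>, every element \<open>\<Sum>\<^sub>e (e x)\<^sub>1 \<langle>e\<^sup>*, \<tau>\<^sup>2 ((e x)\<^sub>2)\<rangle>\<close> is an integral; this is the projection
  onto the coinvariants in the fundamental theorem of Hopf modules. These projections cannot all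
  vanish, as \<open>x\<close> can be recovered from them.

  H-separability makes \<open>\<Lambda>\<close> an integral of all of \<open>A\<close> (\<open>h_separable_integral\<close>). A summand of \<open>A\<^sup>n\<close> is
  generated by elements \<open>p\<^sub>i\<close> with \<open>a p\<^sub>i = p\<^sub>i a\<close>, so that \<open>1 \<otimes> 1 = \<Sum>\<^sub>i r\<^sub>i E\<^sub>i\<close> in \<open>A \<otimes>\<^sub>B A\<close> with
  \<open>a E\<^sub>i = E\<^sub>i a\<close>. Since \<open>\<Lambda>\<close> is an integral of \<open>B\<close>, the map \<open>x \<otimes> y \<mapsto> \<epsilon>(y) x \<Lambda>\<close> is well defined on
  \<open>A \<otimes>\<^sub>B A\<close>; it turns left multiplication by \<open>a\<close> on the \<open>E\<^sub>i\<close> into multiplication by \<open>\<epsilon>(a)\<close>, and it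
  sends \<open>1 \<otimes> 1\<close> to \<open>\<Lambda>\<close>.

  Finally, a Hopf subalgebra containing a nonzero left integral of \<open>A\<close> is \<open>A\<close>
  (\<open>hopf_subalgebra_with_integral_full\<close>). The identity \<open>\<Lambda>\<^sub>1 \<otimes> a \<Lambda>\<^sub>2 = \<tau>(a) \<Lambda>\<^sub>1 \<otimes> \<Lambda>\<^sub>2\<close> shows that the
  elements \<open>\<langle>\<phi>, \<Lambda>\<^sub>1\<rangle> \<Lambda>\<^sub>2\<close> form a left ideal of \<open>A\<close>; this ideal lies in \<open>B\<close>, and the antipode axiom
  produces a nonzero scalar in it.
\<close>

section \<open>Tensor classes\<close>

lemma tensor_eq_rep: "tensor_eq S ract lact u (rep (tensor_class S ract lact u))"
proof -
  have "rep (tensor_class S ract lact u) \<in> tensor_class S ract lact u"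
    unfolding rep_def by (rule someI[of _ u]) (simp add: tensor_class_def tensor_eq.refl)
  then show ?thesis by (simp add: tensor_class_def)
qed

lemma sum_mset_image_sum_mset:
  "(\<Sum>q \<in># (\<Sum>p \<in># M. g p). f q) = (\<Sum>p \<in># M. \<Sum>q \<in># g p. f q)"
  by (induction M) auto

lemma sum_mset_ktensor3_eq:
  fixes f :: "'a::ab_group_add \<Rightarrow> 'a \<Rightarrow> 'a \<Rightarrow> 'c::ab_group_add"
  assumes "ktensor3_eq scale u v"
    and add1: "\<And>x x' y z. f (x + x') y z = f x y z + f x' y z"
    and add2: "\<And>x y y' z. f x (y + y') z = f x y z + f x y' z"
    and add3: "\<And>x y z z'. f x y (z + z') = f x y z + f x y z'"
    and bal12: "\<And>c x y z. f (scale c x) y z = f x (scale c y) z"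
    and bal23: "\<And>c x y z. f x (scale c y) z = f x y (scale c z)"
  shows "(\<Sum>(x, y, z) \<in># u. f x y z) = (\<Sum>(x, y, z) \<in># v. f x y z)"
  using assms(1)
proof induction
  case (zero1 y z)
  show ?case using add1[of 0 0 y z] by simp
next
  case (zero2 x z)
  show ?case using add2[of x 0 0 z] by simp
next
  case (zero3 x y)
  show ?case using add3[of x y 0 0] by simp
qed (simp_all add: add1 add2 add3 bal12 bal23)


section \<open>Sweedler calculus\<close>

text \<open>
  An identity between tensors, such as coassociativity, is used in the form: every multilinear map
  with values in the algebra has the same Sweedler sum on both sides. No tensor power has to be
  handled as a vector space in this way.
\<close>

context hopf_algebra
begin

abbreviation lin :: "('a \<Rightarrow> 'a) \<Rightarrow> bool"
  where "lin \<equiv> Vector_Spaces.linear scale scale"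

abbreviation functional :: "('a \<Rightarrow> 'k) \<Rightarrow> bool"
  where "functional \<equiv> Vector_Spaces.linear scale (*)"

definition bilin :: "('a \<Rightarrow> 'a \<Rightarrow> 'a) \<Rightarrow> bool"
  where "bilin F \<longleftrightarrow> (\<forall>y. lin (\<lambda>x. F x y)) \<and> (\<forall>x. lin (\<lambda>y. F x y))"

definition trilin :: "('a \<Rightarrow> 'a \<Rightarrow> 'a \<Rightarrow> 'a) \<Rightarrow> bool"
  where "trilin F \<longleftrightarrow> (\<forall>z. bilin (\<lambda>x y. F x y z)) \<and> (\<forall>x y. lin (\<lambda>z. F x y z))"

abbreviation sw :: "'a \<Rightarrow> ('a \<Rightarrow> 'a \<Rightarrow> 'c::comm_monoid_add) \<Rightarrow> 'c"
  where "sw \<equiv> sweedler \<Delta>"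

lemma lin_iff: "lin f \<longleftrightarrow> (\<forall>x y. f (x + y) = f x + f y) \<and> (\<forall>c x. f (scale c x) = scale c (f x))"
  by (simp add: Vector_Spaces.linear_iff vector_space_axioms)

lemma functional_iff:
  "functional f \<longleftrightarrow> (\<forall>x y. f (x + y) = f x + f y) \<and> (\<forall>c x. f (scale c x) = c * f x)"
  by (simp add: Vector_Spaces.linear_iff vector_space_axioms vector_space_def algebra_simps)

lemma linD: "lin f \<Longrightarrow> f (x + y) = f x + f y" "lin f \<Longrightarrow> f (scale c x) = scale c (f x)"
  by (simp_all add: lin_iff)

lemma lin_0: "lin f \<Longrightarrow> f 0 = 0"
  using linD(1)[of f 0 0] by simp

lemma lin_sum: "lin f \<Longrightarrow> f (\<Sum>i\<in>I. g i) = (\<Sum>i\<in>I. f (g i))"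
  by (induction I rule: infinite_finite_induct) (auto simp: lin_0 linD)

lemma functional_0: "functional f \<Longrightarrow> f 0 = 0"
  by (metis functional_iff add_cancel_right_left)

lemma functional_sum: "functional f \<Longrightarrow> f (\<Sum>i\<in>I. g i) = (\<Sum>i\<in>I. f (g i))"
  by (induction I rule: infinite_finite_induct) (auto simp: functional_0 functional_iff)

lemma lin_sum_mset: "lin f \<Longrightarrow> f (\<Sum>p\<in>#M. g p) = (\<Sum>p\<in>#M. f (g p))"
  by (induction M) (auto simp: lin_0 linD)

text \<open>
  In a term that is linear in \<open>x\<close>, the variable occurs once. The rules below follow the path to this
  occurrence, so that \<open>intro\<close> proves linearity without search. \<open>functional_comp\<close> applies to its own
  first premise; it is therefore used only with a fixed functional.
\<close>

lemma lin_id: "lin (\<lambda>x. x)" by (simp add: lin_iff)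
lemma lin_mult_right: "lin f \<Longrightarrow> lin (\<lambda>x. f x * a)"
  by (simp add: lin_iff distrib_right scale_mult_left)
lemma lin_mult_left: "lin f \<Longrightarrow> lin (\<lambda>x. a * f x)"
  by (simp add: lin_iff distrib_left scale_mult_right)
lemma lin_scale: "lin f \<Longrightarrow> lin (\<lambda>x. scale c (f x))"
  by (simp add: lin_iff scale_right_distrib mult.commute)
lemma lin_scale_functional: "functional (\<lambda>x. \<phi> x) \<Longrightarrow> lin (\<lambda>x. scale (\<phi> x) a)"
  by (simp add: lin_iff functional_iff scale_left_distrib)
lemma lin_antipode: "lin f \<Longrightarrow> lin (\<lambda>x. \<tau> (f x))"
  using antipode_linear by (simp add: lin_iff)
lemma functional_counit: "lin f \<Longrightarrow> functional (\<lambda>x. \<epsilon> (f x))"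
  using counit_linear by (simp add: functional_iff lin_iff)
lemma functional_comp: "functional \<phi> \<Longrightarrow> lin f \<Longrightarrow> functional (\<lambda>x. \<phi> (f x))"
  by (simp add: functional_iff lin_iff)
lemma functional_mult_left: "functional \<phi> \<Longrightarrow> functional (\<lambda>w. \<phi> (a * w))"
  by (simp add: functional_iff distrib_left scale_mult_right)
lemma bilinI: "(\<And>y. lin (\<lambda>x. F x y)) \<Longrightarrow> (\<And>x. lin (\<lambda>y. F x y)) \<Longrightarrow> bilin F"
  by (simp add: bilin_def)
lemma trilinI:
  "(\<And>y z. lin (\<lambda>x. F x y z)) \<Longrightarrow> (\<And>x z. lin (\<lambda>y. F x y z)) \<Longrightarrow> (\<And>x y. lin (\<lambda>z. F x y z)) \<Longrightarrow> trilin F"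
  by (simp add: trilin_def bilin_def)

lemma bilinD:
  assumes "bilin F"
  shows "F (x + x') y = F x y + F x' y" "F x (y + y') = F x y + F x y'"
    "F (scale c x) y = scale c (F x y)" "F x (scale c y) = scale c (F x y)"
  using assms by (simp_all add: bilin_def lin_iff)

lemma trilinD:
  assumes "trilin F"
  shows "F (x + x') y z = F x y z + F x' y z" "F x (y + y') z = F x y z + F x y' z"
    "F x y (z + z') = F x y z + F x y z'"
    "F (scale c x) y z = scale c (F x y z)" "F x (scale c y) z = scale c (F x y z)"
    "F x y (scale c z) = scale c (F x y z)"
  using assms by (simp_all add: trilin_def bilin_def lin_iff)

text \<open>
  The axioms for sums, multiples, products and \<open>1\<close>, and the definition of a Hopf subalgebra, each give
  some representative of a comultiplication, but not the one that \<open>sweedler\<close> evaluates.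
\<close>

lemma sw_representative:
  assumes F: "bilin F" and u: "\<Delta> x = ktensor scale u"
  shows "sw x F = (\<Sum>(x1, x2) \<in># u. F x1 x2)"
proof -
  have "tensor_eq UNIV (\<lambda>x c. scale c x) scale u (rep (\<Delta> x))"
    unfolding u by (rule tensor_eq_rep)
  then show ?thesis
    unfolding sweedler_def
    by (rule sum_mset_tensor_eq[symmetric]) (simp_all add: bilinD[OF F])
qed

lemma lin_sw_arg:
  assumes F: "bilin F"
  shows "lin (\<lambda>x. sw x F)"
proof -
  have "sw (x + y) F = sw x F + sw y F" for x y
    unfolding sw_representative[OF F comult_add] by (simp add: sweedler_def)
  moreover have "sw (scale c x) F = scale c (sw x F)" for c x
    unfolding sw_representative[OF F comult_scale]
    unfolding sweedler_def case_prod_unfold sum_mset_image_sum_mset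
    by (simp add: lin_sum_mset[OF lin_scale[OF lin_id]] bilinD[OF F])
  ultimately show ?thesis by (simp add: lin_iff)
qed

lemma lin_sw: "lin f \<Longrightarrow> bilin F \<Longrightarrow> lin (\<lambda>x. sw (f x) F)"
  using lin_sw_arg[of F] by (simp add: lin_iff)

lemma lin_sw_body:
  assumes "\<And>x1 x2. lin (\<lambda>z. G z x1 x2)"
  shows "lin (\<lambda>z. sw x (\<lambda>x1 x2. G z x1 x2))"
  using assms unfolding sweedler_def case_prod_unfold lin_iff
  by (auto simp: sum_mset.distrib lin_sum_mset[OF lin_scale[OF lin_id]])

lemma lin_sum_fun: "(\<And>i. lin (\<lambda>x. f i x)) \<Longrightarrow> lin (\<lambda>x. \<Sum>i\<in>I. f i x)"
  by (simp add: lin_iff sum.distrib scale_sum_right)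

lemmas lin_intros = lin_id lin_mult_right lin_mult_left lin_scale lin_antipode lin_scale_functional
  functional_counit bilinI trilinI lin_sw lin_sw_body

lemma lin_sw_commute: "lin f \<Longrightarrow> f (sw x F) = sw x (\<lambda>x1 x2. f (F x1 x2))"
  unfolding sweedler_def by (simp add: lin_sum_mset case_prod_unfold)

lemma sw_mult_left: "(a::'a) * sw x F = sw x (\<lambda>x1 x2. a * F x1 x2)"
  by (rule lin_sw_commute[of "\<lambda>x. a * x"]) (intro lin_intros)
lemma sw_mult_right: "sw x F * (a::'a) = sw x (\<lambda>x1 x2. F x1 x2 * a)"
  by (rule lin_sw_commute[of "\<lambda>x. x * a"]) (intro lin_intros)
lemma sw_scale: "scale c (sw x F) = sw x (\<lambda>x1 x2. scale c (F x1 x2))"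
  by (rule lin_sw_commute[of "scale c"]) (intro lin_intros)
lemma sw_sum: "sw x (\<lambda>x1 x2. \<Sum>i\<in>I. F i x1 x2) = (\<Sum>i\<in>I. sw x (\<lambda>x1 x2. F i x1 x2 :: 'a))"
  unfolding sweedler_def case_prod_unfold
  by (induction I rule: infinite_finite_induct) (auto simp: sum_mset.distrib)

lemma sw_swap:
  "sw x (\<lambda>x1 x2. sw y (\<lambda>y1 y2. F x1 x2 y1 y2)) = sw y (\<lambda>y1 y2. sw x (\<lambda>x1 x2. F x1 x2 y1 y2))"
  unfolding sweedler_def case_prod_unfold by (rule sum_mset.swap)

lemma sw_mult:
  assumes "bilin F"
  shows "sw (x * y) F = sw x (\<lambda>x1 x2. sw y (\<lambda>y1 y2. F (x1 * y1) (x2 * y2)))"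
  unfolding sw_representative[OF assms comult_mult]
  by (simp add: sweedler_def case_prod_unfold sum_mset_image_sum_mset
      image_mset.compositionality comp_def)

lemma sw_one: "bilin F \<Longrightarrow> sw 1 F = F 1 1"
  using sw_representative[OF _ comult_one] by simp

lemma sw_coassoc:
  assumes "trilin F"
  shows "sw x (\<lambda>x1 x2. sw x1 (\<lambda>x11 x12. F x11 x12 x2)) =
    sw x (\<lambda>x1 x2. sw x2 (\<lambda>x21 x22. F x1 x21 x22))"
  using sum_mset_ktensor3_eq[OF coassoc, of F x]
  by (simp add: sweedler_def case_prod_unfold sum_mset_image_sum_mset
      image_mset.compositionality comp_def trilinD[OF assms])

lemma sw_counit_left: "lin f \<Longrightarrow> sw x (\<lambda>x1 x2. scale (\<epsilon> x1) (f x2)) = f x"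
  using lin_sw_commute[of f x "\<lambda>x1 x2. scale (\<epsilon> x1) x2"] by (simp add: counit_left linD)

lemma sw_counit_right: "lin f \<Longrightarrow> sw x (\<lambda>x1 x2. scale (\<epsilon> x2) (f x1)) = f x"
  using lin_sw_commute[of f x "\<lambda>x1 x2. scale (\<epsilon> x2) x1"] by (simp add: counit_right linD)

text \<open>
  Both sides are convolution inverses of multiplication, as maps \<open>A \<otimes> A \<rightarrow> A\<close>: the left side is a left
  inverse and the right side a right inverse. The sum
  \<open>\<tau> (x\<^sub>1 y\<^sub>1) x\<^sub>2 y\<^sub>2 \<tau> y\<^sub>3 \<tau> x\<^sub>3\<close> is therefore equal to each of them.
\<close>

lemma antipode_mult: "\<tau> (x * y) = \<tau> y * \<tau> x"
proof -
  let ?T = "\<lambda>x1 x2 x3 y1 y2 y3. \<tau> (x1 * y1) * (x2 * y2 * (\<tau> y3 * \<tau> x3))"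
  have "sw x (\<lambda>x1 x2. sw x2 (\<lambda>x21 x22. sw y (\<lambda>y1 y2. sw y2 (\<lambda>y21 y22. ?T x1 x21 x22 y1 y21 y22)))) =
     sw x (\<lambda>x1 x2. sw y (\<lambda>y1 y2. \<tau> (x1 * y1) * sw x2 (\<lambda>x21 x22. x21 * sw y2 (\<lambda>y21 y22. y21 * \<tau> y22) * \<tau> x22)))"
    by (simp add: sw_mult_left sw_mult_right mult.assoc sw_swap[of y])
  also have "\<dots> = sw x (\<lambda>x1 x2. sw y (\<lambda>y1 y2. scale (\<epsilon> x2) (scale (\<epsilon> y2) (\<tau> (x1 * y1)))))"
    by (simp add: antipode_right scale_mult_left scale_mult_right flip: sw_scale)
       (simp add: mult.commute)
  also have "\<dots> = \<tau> (x * y)"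
    by (simp add: sw_counit_right lin_intros del: scale_scale flip: sw_scale)
  finally have 1: "sw x (\<lambda>x1 x2. sw x2 (\<lambda>x21 x22. sw y (\<lambda>y1 y2. sw y2 (\<lambda>y21 y22. ?T x1 x21 x22 y1 y21 y22)))) = \<tau> (x * y)" .
  have "sw x (\<lambda>x1 x2. sw x2 (\<lambda>x21 x22. sw y (\<lambda>y1 y2. sw y2 (\<lambda>y21 y22. ?T x1 x21 x22 y1 y21 y22)))) =
    sw x (\<lambda>x1 x2. sw x1 (\<lambda>x11 x12. sw y (\<lambda>y1 y2. sw y1 (\<lambda>y11 y12. ?T x11 x12 x2 y11 y12 y2))))"
    by (simp add: sw_coassoc lin_intros)
  also have "\<dots> = sw x (\<lambda>x1 x2. sw y (\<lambda>y1 y2. sw (x1 * y1) (\<lambda>u1 u2. \<tau> u1 * u2) * (\<tau> y2 * \<tau> x2)))"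
    by (subst sw_mult) (auto intro!: lin_intros simp: sw_mult_right mult.assoc sw_swap[of y])
  also have "\<dots> = sw x (\<lambda>x1 x2. scale (\<epsilon> x1) (sw y (\<lambda>y1 y2. scale (\<epsilon> y1) (\<tau> y2)) * \<tau> x2))"
    by (simp add: antipode_left counit_mult scale_mult_left sw_scale sw_mult_right)
  also have "\<dots> = \<tau> y * \<tau> x"
    by (simp add: sw_counit_left lin_intros)
  finally show ?thesis using 1 by simp
qed

lemma antipode_one: "\<tau> 1 = 1"
  using antipode_left[of 1] by (simp add: sw_one lin_intros counit_one)


section \<open>Dual bases\<close>

text \<open>
  The coordinate functionals are defined on the whole algebra, so that they can be applied before an
  argument is known to lie in \<open>V\<close>.
\<close>

definition dual_basis :: "'a set \<Rightarrow> 'a set \<Rightarrow> ('a \<Rightarrow> 'a \<Rightarrow> 'k) \<Rightarrow> bool"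
  where "dual_basis V E f \<longleftrightarrow> finite E \<and> E \<subseteq> V \<and> (\<forall>e. functional (f e)) \<and>
    (\<forall>v\<in>V. (\<Sum>e\<in>E. scale (f e v) e) = v)"

lemma dual_basis_exists:
  assumes X: "finite X" "V \<subseteq> span X"
  shows "\<exists>E f. dual_basis V E f"
proof -
  obtain E where E: "E \<subseteq> V" "independent E" "V \<subseteq> span E"
    using maximal_independent_subset[of V] by blast
  have fin: "finite E" using independent_span_bound[OF X(1) E(2)] E(1) X(2) by blast
  define f where "f e v = representation (extend_basis E) v e" for e v
  have "functional (f e)" for e
    using E(2) by (simp add: functional_iff f_def representation_add representation_scale
        independent_extend_basis)
  moreover have "(\<Sum>e\<in>E. scale (f e v) e) = v" if "v \<in> V" for v
  proof -
    have "v \<in> span E" using that E(3) by blast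
    then have "f e v = representation E v e" for e
      unfolding f_def
      by (intro fun_cong[OF representation_extend] independent_extend_basis extend_basis_superset E(2))
    then show ?thesis
      using sum_representation_eq[OF E(2) \<open>v \<in> span E\<close> fin subset_refl] by simp
  qed
  ultimately have "dual_basis V E f" using fin E(1) by (simp add: dual_basis_def)
  then show ?thesis by (intro exI)
qed


section \<open>Integrals of a finite-dimensional Hopf subalgebra\<close>

text \<open>
  \<open>contract z \<phi>\<close> is \<open>z\<^sub>1 \<langle>\<phi>, \<tau>\<^sup>2 z\<^sub>2\<rangle>\<close>. The square of the antipode is what makes \<open>mult_contract\<close> hold.
\<close>

definition contract :: "'a \<Rightarrow> ('a \<Rightarrow> 'k) \<Rightarrow> 'a"
  where "contract z \<phi> = sw z (\<lambda>z1 z2. scale (\<phi> (\<tau> (\<tau> z2))) z1)"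

lemma bilin_contract: "functional \<phi> \<Longrightarrow> bilin (\<lambda>z1 z2. scale (\<phi> (\<tau> (\<tau> z2))) z1)"
  by (intro lin_intros) (rule functional_comp[of \<phi>], assumption, intro lin_intros)

lemma lin_contract: "functional \<phi> \<Longrightarrow> lin f \<Longrightarrow> lin (\<lambda>z. contract (f z) \<phi>)"
  unfolding contract_def by (intro lin_sw bilin_contract)

text \<open>
  In \<open>b\<^sub>1 z\<^sub>1 \<langle>\<phi>, \<tau> b\<^sub>3 \<tau>\<^sup>2 b\<^sub>2 \<tau>\<^sup>2 z\<^sub>2\<rangle>\<close> the product \<open>\<tau> b\<^sub>3 \<tau>\<^sup>2 b\<^sub>2 = \<tau> (\<tau> b\<^sub>2 b\<^sub>3)\<close> collapses. So a factor \<open>b\<close> on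
  the left can be moved inside, at the price of \<open>\<tau> b\<^sub>2\<close> in the functional.
\<close>

lemma mult_contract:
  assumes \<phi>: "functional \<phi>"
  shows "b * contract z \<phi> = sw b (\<lambda>b1 b2. contract (b1 * z) (\<lambda>w. \<phi> (\<tau> b2 * w)))"
proof -
  have "sw b (\<lambda>b1 b2. contract (b1 * z) (\<lambda>w. \<phi> (\<tau> b2 * w))) =
    sw b (\<lambda>b1 b2. sw b1 (\<lambda>b11 b12. sw z (\<lambda>z1 z2.
      scale (\<phi> (\<tau> b2 * \<tau> (\<tau> (b12 * z2)))) (b11 * z1))))"
    unfolding contract_def by (subst sw_mult) (auto intro!: lin_intros functional_comp[OF \<phi>])
  also have "\<dots> = sw b (\<lambda>b1 b2. sw b2 (\<lambda>b21 b22. sw z (\<lambda>z1 z2.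
      scale (\<phi> (\<tau> b22 * \<tau> (\<tau> (b21 * z2)))) (b1 * z1))))"
    by (rule sw_coassoc) (intro lin_intros functional_comp[OF \<phi>])
  also have "\<dots> = sw b (\<lambda>b1 b2. sw z (\<lambda>z1 z2. sw b2 (\<lambda>b21 b22.
      scale (\<phi> (\<tau> (\<tau> b21 * b22) * \<tau> (\<tau> z2))) (b1 * z1))))"
    by (simp add: antipode_mult mult.assoc sw_swap[of z])
  also have "\<dots> = sw b (\<lambda>b1 b2. sw z (\<lambda>z1 z2.
      scale (\<phi> (\<tau> (sw b2 (\<lambda>b21 b22. \<tau> b21 * b22)) * \<tau> (\<tau> z2))) (b1 * z1)))"
    by (subst lin_sw_commute[of "\<lambda>u. scale (\<phi> (\<tau> u * \<tau> (\<tau> z2))) (b1 * z1)" for z2 b1 z1])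
      (auto intro!: lin_intros functional_comp[OF \<phi>])
  also have "\<dots> = sw b (\<lambda>b1 b2. scale (\<epsilon> b2) (b1 * contract z \<phi>))"
    unfolding contract_def
    using \<phi> by (simp add: antipode_left antipode_one linD[OF lin_antipode[OF lin_id]] scale_mult_left
      functional_iff sw_scale sw_mult_left scale_mult_right)
  also have "\<dots> = b * contract z \<phi>"
    by (rule sw_counit_right) (intro lin_intros)
  finally show ?thesis by simp
qed

context
  fixes B :: "'a set"
  assumes B: "hopf_subalgebra scale \<Delta> \<tau> B"
begin

lemma subspace_B: "subspace B" and one_B: "1 \<in> B"
  and mult_B: "x \<in> B \<Longrightarrow> y \<in> B \<Longrightarrow> x * y \<in> B"
  and antipode_B: "x \<in> B \<Longrightarrow> \<tau> x \<in> B"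
  using B by (auto simp: hopf_subalgebra_def)

lemma comult_B:
  assumes "b \<in> B"
  obtains u where "set_mset u \<subseteq> B \<times> B" "\<And>F. bilin F \<Longrightarrow> sw b F = (\<Sum>(x, y) \<in># u. F x y)"
proof -
  obtain u where u: "set_mset u \<subseteq> B \<times> B" "\<Delta> b = ktensor scale u"
    using B assms by (auto simp: hopf_subalgebra_def)
  show thesis by (rule that[OF u(1)]) (rule sw_representative[OF _ u(2)])
qed

text \<open>
  Dual bases of \<open>B\<close> expand elements of \<open>B\<close> only. The next two lemmas allow the Sweedler components of
  an element of \<open>B\<close> to be treated as elements of \<open>B\<close>, whatever representative \<open>sweedler\<close> has chosen.
\<close>

lemma sw_cong_B:
  assumes b: "b \<in> B" and "bilin F" "bilin G"
    and eq: "\<And>x y. x \<in> B \<Longrightarrow> y \<in> B \<Longrightarrow> F x y = G x y"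
  shows "sw b F = sw b G"
proof -
  obtain u where u: "set_mset u \<subseteq> B \<times> B" "\<And>F. bilin F \<Longrightarrow> sw b F = (\<Sum>(x, y) \<in># u. F x y)"
    using comult_B[OF b] by blast
  have "(\<Sum>(x, y) \<in># u. F x y) = (\<Sum>(x, y) \<in># u. G x y)"
    using u(1) by (intro arg_cong[where f = sum_mset] image_mset_cong) (auto intro!: eq)
  then show ?thesis using u(2) assms by simp
qed

lemma sw_in_B:
  assumes b: "b \<in> B" and F: "bilin F" and cl: "\<And>x y. x \<in> B \<Longrightarrow> y \<in> B \<Longrightarrow> F x y \<in> B"
  shows "sw b F \<in> B"
proof -
  obtain u where u: "set_mset u \<subseteq> B \<times> B" "\<And>F. bilin F \<Longrightarrow> sw b F = (\<Sum>(x, y) \<in># u. F x y)"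
    using comult_B[OF b] by blast
  have "(\<Sum>(x, y) \<in># u. F x y) \<in> B"
    using u(1) by (induction u) (auto intro!: subspace_0 subspace_add subspace_B cl)
  then show ?thesis using u(2)[OF F] by simp
qed

text \<open>
  The invariance \<open>\<Sum>\<^sub>e b e \<otimes> e\<^sup>* = \<Sum>\<^sub>e e \<otimes> e\<^sup>*(b \<cdot>)\<close> of the canonical tensor, under a pairing \<open>K\<close>. The
  hypothesis \<open>expand\<close> asks \<open>K\<close> to be linear in the functional just where this is needed.
\<close>

lemma dual_basis_shift:
  assumes E: "dual_basis B E f" and b: "b \<in> B"
    and lin: "\<And>e. lin (\<lambda>z. K z (f e))"
    and expand: "\<And>z e. z \<in> E \<Longrightarrow> K z (\<lambda>w. f e (b * w)) = (\<Sum>i\<in>E. scale (f e (b * i)) (K z (f i)))"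
  shows "(\<Sum>e\<in>E. K (b * e) (f e)) = (\<Sum>e\<in>E. K e (\<lambda>w. f e (b * w)))"
proof -
  have "K (b * e) (f e) = (\<Sum>j\<in>E. scale (f j (b * e)) (K j (f e)))" if e: "e \<in> E" for e
  proof -
    have "b * e \<in> B" using e E b mult_B by (auto simp: dual_basis_def)
    then have "b * e = (\<Sum>j\<in>E. scale (f j (b * e)) j)" using E by (auto simp: dual_basis_def)
    then have "K (b * e) (f e) = K (\<Sum>j\<in>E. scale (f j (b * e)) j) (f e)"
      by (rule arg_cong[of _ _ "\<lambda>v. K v (f e)"])
    then show ?thesis by (simp add: lin_sum[OF lin] linD[OF lin])
  qed
  then have "(\<Sum>e\<in>E. K (b * e) (f e)) = (\<Sum>e\<in>E. \<Sum>j\<in>E. scale (f j (b * e)) (K j (f e)))" by simp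
  also have "\<dots> = (\<Sum>j\<in>E. \<Sum>e\<in>E. scale (f j (b * e)) (K j (f e)))" by (rule sum.swap)
  finally show ?thesis by (simp add: expand)
qed

lemma dual_basis_expand:
  assumes E: "dual_basis B E f" and "b \<in> B" "w \<in> B"
  shows "f e (b * w) = (\<Sum>i\<in>E. f e (b * i) * f i w)"
proof -
  have l: "functional (\<lambda>w. f e (b * w))" using E functional_mult_left by (auto simp: dual_basis_def)
  have "f e (b * w) = f e (b * (\<Sum>i\<in>E. scale (f i w) i))" using E assms by (auto simp: dual_basis_def)
  also have "\<dots> = (\<Sum>i\<in>E. f e (b * i) * f i w)"
    using l by (simp add: functional_sum[OF l] functional_iff mult.commute)
  finally show ?thesis .
qed

text \<open>
  The projection onto integrals from the fundamental theorem of Hopf modules: it applies the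
  antipode of \<open>B\<^sup>*\<close> to the coaction \<open>x \<mapsto> \<Sum>\<^sub>e e x \<otimes> e\<^sup>*\<close> of \<open>B\<^sup>*\<close> on \<open>B\<close>, and then lets \<open>\<psi> \<in> B\<^sup>*\<close> act by
  \<open>z \<mapsto> z\<^sub>1 \<langle>\<psi>, \<tau> z\<^sub>2\<rangle>\<close>.
\<close>

definition integral_trace :: "'a set \<Rightarrow> ('a \<Rightarrow> 'a \<Rightarrow> 'k) \<Rightarrow> 'a \<Rightarrow> 'a"
  where "integral_trace E f x = (\<Sum>e\<in>E. contract (e * x) (f e))"

lemma integral_trace_in_B:
  assumes E: "dual_basis B E f" and x: "x \<in> B"
  shows "integral_trace E f x \<in> B"
proof -
  have "contract (e * x) (f e) \<in> B" if "e \<in> E" for e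
    unfolding contract_def
  proof (rule sw_in_B)
    show "e * x \<in> B" using that E x mult_B by (auto simp: dual_basis_def)
    show "bilin (\<lambda>z1 z2. scale (f e (\<tau> (\<tau> z2))) z1)"
      using E bilin_contract by (simp add: dual_basis_def)
  qed (rule subspace_scale[OF subspace_B])
  then show ?thesis unfolding integral_trace_def by (intro subspace_sum subspace_B)
qed

text \<open>
  \<open>mult_contract\<close> moves \<open>b\<close> inside as \<open>b\<^sub>1\<close> and \<open>\<tau> b\<^sub>2\<close>; \<open>dual_basis_shift\<close> carries \<open>b\<^sub>1\<close> over to the
  functional, where it meets \<open>\<tau> b\<^sub>2\<close> in the antipode axiom \<open>b\<^sub>1 \<tau> b\<^sub>2 = \<epsilon>(b)\<close>.
\<close>

lemma integral_trace_integral: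
  assumes E: "dual_basis B E f" and b: "b \<in> B" and x: "x \<in> B"
  shows "b * integral_trace E f x = scale (\<epsilon> b) (integral_trace E f x)"
proof -
  have f: "functional (f e)" for e using E by (simp add: dual_basis_def)
  have "b * integral_trace E f x = sw b (\<lambda>b1 b2. \<Sum>e\<in>E. contract (b1 * e * x) (\<lambda>w. f e (\<tau> b2 * w)))"
    by (simp add: integral_trace_def sum_distrib_left mult_contract[OF f] sw_sum mult.assoc)
  also have "\<dots> = sw b (\<lambda>b1 b2. \<Sum>e\<in>E. contract (e * x) (\<lambda>w. f e (b1 * (\<tau> b2 * w))))"
  proof (rule sw_cong_B[OF b])
    show "bilin (\<lambda>b1 b2. \<Sum>e\<in>E. contract (b1 * e * x) (\<lambda>w. f e (\<tau> b2 * w)))"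
      unfolding contract_def by (intro lin_intros lin_sum_fun functional_comp[OF f])
    show "bilin (\<lambda>b1 b2. \<Sum>e\<in>E. contract (e * x) (\<lambda>w. f e (b1 * (\<tau> b2 * w))))"
      unfolding contract_def by (intro lin_intros lin_sum_fun functional_comp[OF f])
    fix b1 b2 assume b12: "b1 \<in> B" "b2 \<in> B"
    show "(\<Sum>e\<in>E. contract (b1 * e * x) (\<lambda>w. f e (\<tau> b2 * w))) = (\<Sum>e\<in>E. contract (e * x) (\<lambda>w. f e (b1 * (\<tau> b2 * w))))"
    proof (rule dual_basis_shift[OF E b12(1), where K = "\<lambda>z \<phi>. contract (z * x) (\<lambda>w. \<phi> (\<tau> b2 * w))"])
      show "lin (\<lambda>z. contract (z * x) (\<lambda>w. f e (\<tau> b2 * w)))" for e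
        by (intro lin_contract functional_mult_left f lin_intros)
      fix z e assume "z \<in> E"
      then have z: "z * x \<in> B" using E x mult_B by (auto simp: dual_basis_def)
      show "contract (z * x) (\<lambda>w. f e (b1 * (\<tau> b2 * w))) = (\<Sum>i\<in>E. scale (f e (b1 * i)) (contract (z * x) (\<lambda>w. f i (\<tau> b2 * w))))"
        unfolding contract_def sw_scale sw_sum[symmetric]
      proof (rule sw_cong_B[OF z])
        fix z1 z2 assume z12: "z1 \<in> B" "z2 \<in> B"
        then have "\<tau> b2 * \<tau> (\<tau> z2) \<in> B" using b12 antipode_B mult_B by simp
        from dual_basis_expand[OF E b12(1) this]
        show "scale (f e (b1 * (\<tau> b2 * \<tau> (\<tau> z2)))) z1 =
          (\<Sum>i\<in>E. scale (f e (b1 * i)) (scale (f i (\<tau> b2 * \<tau> (\<tau> z2))) z1))"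
          by (simp add: scale_sum_left)
      qed (intro lin_intros lin_sum_fun functional_comp[OF f])+
    qed
  qed
  also have "\<dots> = (\<Sum>e\<in>E. sw (e * x) (\<lambda>z1 z2. sw b (\<lambda>b1 b2. scale (f e (b1 * \<tau> b2 * \<tau> (\<tau> z2))) z1)))"
    unfolding contract_def sw_sum by (simp add: sw_swap[of b] mult.assoc)
  also have "\<dots> = (\<Sum>e\<in>E. sw (e * x) (\<lambda>z1 z2. scale (f e (sw b (\<lambda>b1 b2. b1 * \<tau> b2) * \<tau> (\<tau> z2))) z1))"
    by (subst lin_sw_commute[of "\<lambda>u. scale (f e (u * \<tau> (\<tau> z2))) z1" for z2 e z1])
      (auto intro!: lin_intros functional_comp[OF f])
  also have "\<dots> = scale (\<epsilon> b) (integral_trace E f x)"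
    using f by (simp add: antipode_right integral_trace_def contract_def scale_sum_right sw_scale scale_mult_left functional_iff)
  finally show ?thesis .
qed

text \<open>
  This is the Hopf module identity \<open>m = \<pi>(m\<^sub>0) m\<^sub>1\<close> for the projection \<open>\<pi>\<close> above, and it shows that \<open>\<pi>\<close>
  does not vanish. After one application of \<open>dual_basis_shift\<close> the two sets of dual bases are
  separated: the sum over \<open>i\<close> produces \<open>\<tau>\<^sup>2 z\<^sub>3 \<tau> z\<^sub>2 = \<tau> (z\<^sub>2 \<tau> z\<^sub>3)\<close>, which collapses, and the sum over
  \<open>j\<close> expands \<open>1\<close>.
\<close>

lemma integral_trace_reconstruct:
  assumes E: "dual_basis B E f" and x: "x \<in> B"
  shows "(\<Sum>j\<in>E. sw (integral_trace E f (j * x)) (\<lambda>z1 z2. scale (f j (\<tau> z2)) z1)) = x"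
proof -
  have f: "functional (f e)" for e using E by (simp add: dual_basis_def)
  \<comment> \<open>\<open>?K i (i * j) (f j)\<close> is the contribution of the pair \<open>(i, j)\<close>.\<close>
  let ?K = "\<lambda>i z \<phi>. sw (z * x) (\<lambda>z1 z2. scale (f i (\<tau> (\<tau> z2))) (sw z1 (\<lambda>z11 z12. scale (\<phi> (\<tau> z12)) z11)))"
  have Q: "bilin (\<lambda>z1 z2. scale (f j (\<tau> z2)) z1)" for j
    by (intro lin_intros functional_comp[OF f])
  have shift: "(\<Sum>j\<in>E. ?K i (i * j) (f j)) = (\<Sum>j\<in>E. ?K i j (\<lambda>w. f j (i * w)))" if "i \<in> E" for i
  proof (rule dual_basis_shift[OF E])
    show "i \<in> B" using that E by (auto simp: dual_basis_def)
    show "lin (\<lambda>z. ?K i z (f e))" for e by (intro lin_intros functional_comp[OF f])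
    fix z e assume "z \<in> E"
    then have z: "z * x \<in> B" using E x mult_B by (auto simp: dual_basis_def)
    show "?K i z (\<lambda>w. f e (i * w)) = (\<Sum>k\<in>E. scale (f e (i * k)) (?K i z (f k)))"
      unfolding sw_scale sw_sum[symmetric]
    proof (rule sw_cong_B[OF z])
      fix z1 z2 assume "z1 \<in> B" "z2 \<in> B"
      show "sw z1 (\<lambda>z11 z12. scale (f i (\<tau> (\<tau> z2))) (scale (f e (i * \<tau> z12)) z11)) =
        sw z1 (\<lambda>z11 z12. \<Sum>k\<in>E. scale (f e (i * k)) (scale (f i (\<tau> (\<tau> z2))) (scale (f k (\<tau> z12)) z11)))"
      proof (rule sw_cong_B[OF \<open>z1 \<in> B\<close>])
        fix z11 z12 assume "z11 \<in> B" "z12 \<in> B"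
        from dual_basis_expand[OF E \<open>i \<in> B\<close> antipode_B[OF this(2)]]
        show "scale (f i (\<tau> (\<tau> z2))) (scale (f e (i * \<tau> z12)) z11) =
          (\<Sum>k\<in>E. scale (f e (i * k)) (scale (f i (\<tau> (\<tau> z2))) (scale (f k (\<tau> z12)) z11)))"
          by (simp add: scale_sum_left scale_sum_right mult_ac)
      qed (intro lin_intros lin_sum_fun functional_comp[OF f])+
    qed (intro lin_intros lin_sum_fun functional_comp[OF f])+
  qed
  have collapse: "(\<Sum>i\<in>E. ?K i j (\<lambda>w. f j (i * w))) = scale (f j 1) (j * x)" if "j \<in> E" for j
  proof -
    let ?y = "j * x"
    have y: "?y \<in> B" using that E x mult_B by (auto simp: dual_basis_def)
    have "(\<Sum>i\<in>E. ?K i j (\<lambda>w. f j (i * w))) =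
      sw ?y (\<lambda>z1 z2. sw z1 (\<lambda>z11 z12. scale (f j (\<tau> (\<tau> z2) * \<tau> z12)) z11))"
      unfolding sw_scale sw_sum[symmetric]
    proof (rule sw_cong_B[OF y])
      fix z1 z2 assume "z1 \<in> B" "z2 \<in> B"
      then have "\<tau> (\<tau> z2) \<in> B" using antipode_B by simp
      then have "\<tau> (\<tau> z2) = (\<Sum>i\<in>E. scale (f i (\<tau> (\<tau> z2))) i)" using E by (simp add: dual_basis_def)
      then have "f j (\<tau> (\<tau> z2) * u) = f j ((\<Sum>i\<in>E. scale (f i (\<tau> (\<tau> z2))) i) * u)" for u
        by (rule arg_cong[of _ _ "\<lambda>v. f j (v * u)"])
      then have "f j (\<tau> (\<tau> z2) * u) = (\<Sum>i\<in>E. f i (\<tau> (\<tau> z2)) * f j (i * u))" for u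
        using f by (simp add: sum_distrib_right functional_sum[OF f] scale_mult_left functional_iff)
      then show "sw z1 (\<lambda>z11 z12. \<Sum>i\<in>E. scale (f i (\<tau> (\<tau> z2))) (scale (f j (i * \<tau> z12)) z11)) =
        sw z1 (\<lambda>z11 z12. scale (f j (\<tau> (\<tau> z2) * \<tau> z12)) z11)"
        by (simp add: scale_sum_left)
    qed (intro lin_intros lin_sum_fun functional_comp[OF f])+
    also have "\<dots> = sw ?y (\<lambda>z1 z2. sw z2 (\<lambda>z21 z22. scale (f j (\<tau> (z21 * \<tau> z22))) z1))"
      unfolding antipode_mult by (rule sw_coassoc) (intro lin_intros functional_comp[OF f])
    also have "\<dots> = sw ?y (\<lambda>z1 z2. scale (f j (\<tau> (sw z2 (\<lambda>z21 z22. z21 * \<tau> z22)))) z1)"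
      by (subst lin_sw_commute[of "\<lambda>u. scale (f j (\<tau> u)) z1" for z1])
        (auto intro!: lin_intros functional_comp[OF f])
    also have "\<dots> = sw ?y (\<lambda>z1 z2. scale (\<epsilon> z2) (scale (f j 1) z1))"
      using f by (simp add: antipode_right antipode_one linD[OF lin_antipode[OF lin_id]] functional_iff)
    also have "\<dots> = scale (f j 1) ?y"
      by (rule sw_counit_right) (intro lin_intros)
    finally show ?thesis .
  qed
  have "sw (integral_trace E f (j * x)) (\<lambda>z1 z2. scale (f j (\<tau> z2)) z1) = (\<Sum>i\<in>E. ?K i (i * j) (f j))" for j
    unfolding integral_trace_def contract_def
    by (simp add: lin_sum[OF lin_sw_arg[OF Q]] lin_sw_commute[OF lin_sw_arg[OF Q]] linD[OF lin_sw_arg[OF Q]] mult.assoc)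
  then have "(\<Sum>j\<in>E. sw (integral_trace E f (j * x)) (\<lambda>z1 z2. scale (f j (\<tau> z2)) z1)) =
    (\<Sum>j\<in>E. \<Sum>i\<in>E. ?K i (i * j) (f j))" by simp
  also have "\<dots> = (\<Sum>i\<in>E. \<Sum>j\<in>E. ?K i (i * j) (f j))" by (rule sum.swap)
  also have "\<dots> = (\<Sum>i\<in>E. \<Sum>j\<in>E. ?K i j (\<lambda>w. f j (i * w)))" using shift by simp
  also have "\<dots> = (\<Sum>j\<in>E. \<Sum>i\<in>E. ?K i j (\<lambda>w. f j (i * w)))" by (rule sum.swap)
  also have "\<dots> = (\<Sum>j\<in>E. scale (f j 1) (j * x))" using collapse by simp
  also have "\<dots> = (\<Sum>j\<in>E. scale (f j 1) j) * x" by (simp add: sum_distrib_right scale_mult_left)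
  also have "\<dots> = x" using E one_B by (auto simp: dual_basis_def)
  finally show ?thesis .
qed

lemma integral_exists:
  assumes "finite X" "B \<subseteq> span X"
  shows "\<exists>\<Lambda>\<in>B. \<Lambda> \<noteq> 0 \<and> (\<forall>b\<in>B. b * \<Lambda> = scale (\<epsilon> b) \<Lambda>)"
proof -
  obtain E f where E: "dual_basis B E f" using dual_basis_exists[OF assms] by blast
  have f: "functional (f e)" for e using E by (simp add: dual_basis_def)
  have EB: "e \<in> B" if "e \<in> E" for e using that E by (auto simp: dual_basis_def)
  have "\<exists>j\<in>E. integral_trace E f j \<noteq> 0"
  proof (rule ccontr)
    assume "\<not> ?thesis"
    moreover have "sw 0 (\<lambda>z1 z2. scale (f j (\<tau> z2)) z1) = 0" for j
      by (rule lin_0[OF lin_sw_arg]) (intro lin_intros functional_comp[OF f])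
    ultimately show False using integral_trace_reconstruct[OF E one_B] by simp
  qed
  then obtain j where j: "j \<in> E" "integral_trace E f j \<noteq> 0" by blast
  show ?thesis
    using j integral_trace_in_B[OF E EB[OF j(1)]] integral_trace_integral[OF E _ EB[OF j(1)]] by blast
qed

end

text \<open>
  \<open>\<Lambda>\<^sub>1 \<otimes> a \<Lambda>\<^sub>2 = \<tau> a\<^sub>1 a\<^sub>2 \<Lambda>\<^sub>1 \<otimes> a\<^sub>3 \<Lambda>\<^sub>2 = \<tau> a\<^sub>1 (a\<^sub>2 \<Lambda>)\<^sub>1 \<otimes> (a\<^sub>2 \<Lambda>)\<^sub>2\<close>, and \<open>a\<^sub>2\<close> acts on \<open>\<Lambda>\<close> through \<open>\<epsilon>\<close>.
\<close>

lemma integral_shift: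
  assumes \<Lambda>: "\<And>a. a * \<Lambda> = scale (\<epsilon> a) \<Lambda>" and G: "bilin G"
  shows "sw \<Lambda> (\<lambda>x y. G x (a * y)) = sw \<Lambda> (\<lambda>x y. G (\<tau> a * x) y)"
proof -
  have G1: "lin h \<Longrightarrow> lin (\<lambda>x. G (h x) y)" and G2: "lin h \<Longrightarrow> lin (\<lambda>y. G x (h y))" for h x y
    using bilinD[OF G] by (simp_all add: lin_iff)
  have "sw a (\<lambda>a1 a2. sw (a2 * \<Lambda>) (\<lambda>x y. G (\<tau> a1 * x) y)) =
    sw a (\<lambda>a1 a2. sw a2 (\<lambda>a21 a22. sw \<Lambda> (\<lambda>x y. G (\<tau> a1 * a21 * x) (a22 * y))))"
    by (subst sw_mult) (simp_all add: mult.assoc bilinI G1 G2 lin_mult_left lin_id)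
  also have "\<dots> = sw a (\<lambda>a1 a2. sw a1 (\<lambda>a11 a12. sw \<Lambda> (\<lambda>x y. G (\<tau> a11 * a12 * x) (a2 * y))))"
    by (rule sw_coassoc[symmetric]) (intro lin_intros G1 G2)
  also have "\<dots> = sw a (\<lambda>a1 a2. sw \<Lambda> (\<lambda>x y. G (sw a1 (\<lambda>a11 a12. \<tau> a11 * a12) * x) (a2 * y)))"
    by (subst lin_sw_commute[of "\<lambda>u. sw \<Lambda> (\<lambda>x y. G (u * x) (a2 * y))" for a2])
      (auto intro!: lin_intros G1 G2)
  also have "\<dots> = sw a (\<lambda>a1 a2. scale (\<epsilon> a1) (sw \<Lambda> (\<lambda>x y. G x (a2 * y))))"
    by (simp add: antipode_left scale_mult_left bilinD[OF G] sw_scale)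
  also have "\<dots> = sw \<Lambda> (\<lambda>x y. G x (a * y))"
    by (rule sw_counit_left) (intro lin_intros G1 G2)
  finally have 1: "sw a (\<lambda>a1 a2. sw (a2 * \<Lambda>) (\<lambda>x y. G (\<tau> a1 * x) y)) = sw \<Lambda> (\<lambda>x y. G x (a * y))" .
  have "bilin (\<lambda>x y. G (\<tau> a1 * x) y)" for a1 by (intro lin_intros G1 G2)
  then have "sw a (\<lambda>a1 a2. sw (a2 * \<Lambda>) (\<lambda>x y. G (\<tau> a1 * x) y)) =
    sw a (\<lambda>a1 a2. scale (\<epsilon> a2) (sw \<Lambda> (\<lambda>x y. G (\<tau> a1 * x) y)))"
    using lin_sw_arg by (simp add: \<Lambda> lin_iff)
  also have "\<dots> = sw \<Lambda> (\<lambda>x y. G (\<tau> a * x) y)"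
    by (rule sw_counit_right) (intro lin_intros G1 G2)
  finally show ?thesis using 1 by simp
qed

text \<open>
  The elements \<open>\<langle>\<phi>, \<Lambda>\<^sub>1\<rangle> \<Lambda>\<^sub>2\<close> lie in \<open>B\<close>, and so do their left multiples by \<open>integral_shift\<close>. For a
  functional \<open>g\<close> with \<open>\<langle>g, \<Lambda>\<rangle> \<noteq> 0\<close>, the scalar \<open>\<langle>g, \<Lambda>\<rangle> = \<langle>g, \<Lambda>\<^sub>1\<rangle> \<tau> \<Lambda>\<^sub>2 \<Lambda>\<^sub>3\<close> is a sum of such multiples, so
  every element of the algebra lies in \<open>B\<close>.
\<close>

lemma hopf_subalgebra_with_integral_full:
  assumes B: "hopf_subalgebra scale \<Delta> \<tau> B" and X: "finite X" "span X = UNIV"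
    and \<Lambda>: "\<Lambda> \<in> B" "\<Lambda> \<noteq> 0" "\<And>a. a * \<Lambda> = scale (\<epsilon> a) \<Lambda>"
  shows "B = UNIV"
proof -
  obtain E f where E: "dual_basis UNIV E f"
    using dual_basis_exists[OF X(1), of UNIV] X(2) by auto
  have f: "functional (f e)" for e using E by (simp add: dual_basis_def)
  have expand: "(\<Sum>e\<in>E. scale (f e v) e) = v" for v using E by (simp add: dual_basis_def)
  define D where "D \<phi> = sw \<Lambda> (\<lambda>x y. scale (\<phi> x) y)" for \<phi>
  have D_B: "D \<phi> \<in> B" if "functional \<phi>" for \<phi>
    unfolding D_def
    by (rule sw_in_B[OF B \<Lambda>(1)])
      (auto intro!: lin_intros functional_comp[OF that] subspace_scale[OF subspace_B[OF B]])
  have D_left: "a * D (f e) \<in> B" for a e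
  proof -
    have "bilin (\<lambda>x y. scale (f e x) y)" by (intro lin_intros functional_comp[OF f])
    from integral_shift[OF \<Lambda>(3) this, of a]
    have "a * D (f e) = D (\<lambda>x. f e (\<tau> a * x))"
      by (simp add: D_def sw_mult_left scale_mult_right)
    then show ?thesis using D_B functional_mult_left[OF f] by simp
  qed
  have "\<exists>e. f e \<Lambda> \<noteq> 0"
  proof (rule ccontr)
    assume "\<not> ?thesis"
    then have "(\<Sum>e\<in>E. scale (f e \<Lambda>) e) = 0" by simp
    then show False using expand \<Lambda>(2) by simp
  qed
  then obtain e0 where e0: "f e0 \<Lambda> \<noteq> 0" ..
  let ?g = "f e0"
  define w where "w x = sw x (\<lambda>x1 x2. scale (?g x1) (\<tau> x2))" for x
  have w: "lin w" unfolding w_def by (intro lin_intros functional_comp[OF f])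
  have "sw \<Lambda> (\<lambda>x y. w x * y) = sw \<Lambda> (\<lambda>x y. sw x (\<lambda>x1 x2. scale (?g x1) (\<tau> x2 * y)))"
    by (simp add: w_def sw_mult_right scale_mult_left)
  also have "\<dots> = sw \<Lambda> (\<lambda>x y. sw y (\<lambda>y1 y2. scale (?g x) (\<tau> y1 * y2)))"
    by (rule sw_coassoc) (intro lin_intros functional_comp[OF f])
  also have "\<dots> = sw \<Lambda> (\<lambda>x y. scale (\<epsilon> y) (scale (?g x) 1))"
    by (simp add: antipode_left mult.commute flip: sw_scale)
  also have "\<dots> = scale (?g \<Lambda>) 1"
    by (rule sw_counit_right) (intro lin_intros functional_comp[OF f])
  finally have one: "sw \<Lambda> (\<lambda>x y. w x * y) = scale (?g \<Lambda>) 1" .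
  \<comment> \<open>In \<open>w(\<Lambda>\<^sub>1) \<Lambda>\<^sub>2\<close>, expanding \<open>\<Lambda>\<^sub>1\<close> in the basis makes the second factors
    \<open>\<langle>f\<^sub>e, \<Lambda>\<^sub>1\<rangle> \<Lambda>\<^sub>2\<close>, independently of the representative of \<open>\<Delta> \<Lambda>\<close>.\<close>
  have w_expand: "w x = (\<Sum>e\<in>E. scale (f e x) (w e))" for x
    by (subst (1) expand[symmetric]) (simp add: lin_sum[OF w] linD[OF w])
  have "sw \<Lambda> (\<lambda>x y. w x * y) = sw \<Lambda> (\<lambda>x y. (\<Sum>e\<in>E. scale (f e x) (w e)) * y)"
    by (simp only: w_expand[symmetric])
  also have "\<dots> = (\<Sum>e\<in>E. w e * D (f e))"
    by (simp add: D_def sum_distrib_right sw_sum sw_mult_left scale_mult_left scale_mult_right)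
  finally have gen: "scale (?g \<Lambda>) 1 = (\<Sum>e\<in>E. w e * D (f e))" using one by simp
  have "a \<in> B" for a
  proof -
    have "scale (?g \<Lambda>) a = a * scale (?g \<Lambda>) 1" by (simp add: scale_mult_right)
    also have "\<dots> = (\<Sum>e\<in>E. a * w e * D (f e))" by (simp add: gen sum_distrib_left mult.assoc)
    also have "\<dots> \<in> B" by (intro subspace_sum subspace_B[OF B] D_left)
    finally have "scale (inverse (?g \<Lambda>)) (scale (?g \<Lambda>) a) \<in> B"
      by (rule subspace_scale[OF subspace_B[OF B]])
    then show ?thesis using e0 by simp
  qed
  then show ?thesis by blast
qed

end


section \<open>H-separability\<close>

text \<open>
  The \<open>p\<^sub>i\<close> are the components in \<open>N\<close> of the standard generators \<open>\<delta>\<^sub>i\<close> of \<open>A\<^sup>n\<close>. The relations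
  \<open>a \<delta>\<^sub>i = \<delta>\<^sub>i a\<close> and \<open>r = \<Sum>\<^sub>i r\<^sub>i \<delta>\<^sub>i\<close> pass to the components because the decomposition is unique and
  compatible with both actions.
\<close>

lemma direct_summand_power_generated:
  fixes r :: "nat \<Rightarrow> 'a::ring_1"
  assumes N: "direct_summand N (power_bimodule n)" and r: "r \<in> N"
  shows "\<exists>p. (\<forall>i<n. p i \<in> N) \<and> (\<forall>i<n. \<forall>a. (\<lambda>j. a * p i j) = (\<lambda>j. p i j * a)) \<and>
    r = (\<lambda>j. \<Sum>i<n. r i * p i j)"
proof -
  let ?M = "power_bimodule n :: ('a, nat \<Rightarrow> 'a) bimodule"
  from N obtain N' where N: "sub_bimodule N ?M" and N': "sub_bimodule N' ?M"
    and decomp: "\<forall>m\<in>bcarrier ?M. \<exists>!p. p \<in> N \<times> N' \<and> badd ?M (fst p) (snd p) = m"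
    by (auto simp: direct_summand_def)
  have uniq: "p = p'" if "p \<in> N" "p' \<in> N" "q \<in> N'" "q' \<in> N'"
    "(\<lambda>j. p j + q j) = (\<lambda>j. p' j + q' j)" for p p' q q'
  proof -
    have "p \<in> bcarrier ?M" "q \<in> bcarrier ?M" using that(1,3) N N' by (auto simp: sub_bimodule_def)
    then have "(\<lambda>j. p j + q j) \<in> bcarrier ?M" by (simp add: power_bimodule_def)
    then have "\<exists>!x. x \<in> N \<times> N' \<and> badd ?M (fst x) (snd x) = (\<lambda>j. p j + q j)" using decomp by blast
    moreover have "(p, q) \<in> N \<times> N' \<and> badd ?M (fst (p, q)) (snd (p, q)) = (\<lambda>j. p j + q j)"
      "(p', q') \<in> N \<times> N' \<and> badd ?M (fst (p', q')) (snd (p', q')) = (\<lambda>j. p j + q j)"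
      using that by (simp_all add: power_bimodule_def)
    ultimately have "(p, q) = (p', q')" by blast
    then show ?thesis by simp
  qed
  have comb: "(\<lambda>j. \<Sum>i<k. c i * s i j) \<in> S"
    if S: "sub_bimodule S ?M" and "\<And>i. i < n \<Longrightarrow> s i \<in> S" "k \<le> n" for S c s k
    using that(3)
  proof (induction k)
    case 0
    obtain x where "x \<in> S" using S by (auto simp: sub_bimodule_def)
    then have "blact ?M 0 x \<in> S" using S by (auto simp: sub_bimodule_def)
    then show ?case by (simp add: power_bimodule_def)
  next
    case (Suc k)
    then have "blact ?M (c k) (s k) \<in> S" using S that(2) by (simp add: sub_bimodule_def)
    then have "badd ?M (\<lambda>j. \<Sum>i<k. c i * s i j) (blact ?M (c k) (s k)) \<in> S"
      using S Suc by (simp add: sub_bimodule_def)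
    then show ?case by (simp add: power_bimodule_def)
  qed
  define \<delta> where "\<delta> i j = (if j = i then 1 else 0 :: 'a)" for i j :: nat
  have "\<forall>i\<in>{..<n}. \<exists>x. x \<in> N \<times> N' \<and> badd ?M (fst x) (snd x) = \<delta> i"
  proof
    fix i assume "i \<in> {..<n}"
    then have "\<delta> i \<in> bcarrier ?M" by (auto simp: \<delta>_def power_bimodule_def)
    then show "\<exists>x. x \<in> N \<times> N' \<and> badd ?M (fst x) (snd x) = \<delta> i" using decomp by blast
  qed
  from bchoice[OF this] obtain x where
    x: "\<forall>i\<in>{..<n}. x i \<in> N \<times> N' \<and> badd ?M (fst (x i)) (snd (x i)) = \<delta> i" ..
  define p q where "p i = fst (x i)" and "q i = snd (x i)" for i
  have pq: "p i \<in> N" "q i \<in> N'" "(\<lambda>j. p i j + q i j) = \<delta> i" if "i < n" for i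
    using x that by (auto simp: p_def q_def power_bimodule_def mem_Times_iff)
  have act: "(\<lambda>j. a * s j) \<in> S" "(\<lambda>j. s j * a) \<in> S" if "sub_bimodule S ?M" "s \<in> S" for S s a
  proof -
    have "blact ?M a s \<in> S" "bract ?M s a \<in> S" using that by (simp_all add: sub_bimodule_def)
    then show "(\<lambda>j. a * s j) \<in> S" "(\<lambda>j. s j * a) \<in> S" by (simp_all add: power_bimodule_def)
  qed
  have central: "(\<lambda>j. a * p i j) = (\<lambda>j. p i j * a)" if i: "i < n" for i a
  proof (rule uniq)
    have "p i j + q i j = \<delta> i j" for j using pq(3)[OF i] by (rule fun_cong)
    then show "(\<lambda>j. a * p i j + a * q i j) = (\<lambda>j. p i j * a + q i j * a)"
      by (simp add: \<delta>_def fun_eq_iff flip: distrib_left distrib_right)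
  qed (use pq(1,2)[OF i] act N N' in auto)
  have zero: "(\<lambda>j. 0) \<in> N'"
  proof -
    obtain x where "x \<in> N'" using N' by (auto simp: sub_bimodule_def)
    then show ?thesis using act(1)[OF N', of x 0] by simp
  qed
  have "r = (\<lambda>j. \<Sum>i<n. r i * p i j)"
  proof (rule uniq[OF r _ zero])
    show "(\<lambda>j. \<Sum>i<n. r i * p i j) \<in> N" by (rule comb[OF N pq(1)]) auto
    show "(\<lambda>j. \<Sum>i<n. r i * q i j) \<in> N'" by (rule comb[OF N' pq(2)]) auto
    have rz: "r j = 0" if "n \<le> j" for j
      using r N that by (auto simp: sub_bimodule_def power_bimodule_def)
    have "(\<Sum>i<n. r i * p i j) + (\<Sum>i<n. r i * q i j) = r j" for j
    proof -
      have "(\<Sum>i<n. r i * p i j) + (\<Sum>i<n. r i * q i j) = (\<Sum>i<n. r i * (p i j + q i j))"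
        by (simp add: sum.distrib distrib_left)
      also have "\<dots> = (\<Sum>i<n. r i * \<delta> i j)"
        by (intro sum.cong refl arg_cong2[of _ _ _ _ "(*)"] fun_cong[OF pq(3)]) auto
      also have "\<dots> = (\<Sum>i<n. if i = j then r i else 0)" by (intro sum.cong) (auto simp: \<delta>_def)
      also have "\<dots> = r j" using rz by auto
      finally show ?thesis .
    qed
    then show "(\<lambda>j. r j + 0) = (\<lambda>j. (\<Sum>i<n. r i * p i j) + (\<Sum>i<n. r i * q i j))" by simp
  qed
  with pq(1) central show ?thesis by (intro exI[of _ p]) simp
qed

context hopf_algebra
begin

text \<open>
  On the image of \<open>p\<^sub>i\<close> the left action of \<open>a\<close> equals the right action, which is scaling by \<open>\<epsilon>(a)\<close>; and
  \<open>\<Lambda>\<close>, the image of \<open>1 \<otimes> 1\<close>, is a linear combination of these images, since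
  \<open>r\<^sub>i p\<^sub>i = p\<^sub>i r\<^sub>i\<close> is sent to \<open>\<epsilon>(r\<^sub>i)\<close> times the image of \<open>p\<^sub>i\<close>.
\<close>

lemma h_separable_integral:
  assumes hsep: "h_separable B" and \<Lambda>: "\<And>b. b \<in> B \<Longrightarrow> b * \<Lambda> = scale (\<epsilon> b) \<Lambda>"
  shows "a * \<Lambda> = scale (\<epsilon> a) \<Lambda>"
proof -
  let ?T = "tensor_bimodule B"
  obtain n N f where N: "direct_summand N (power_bimodule n)"
    and iso: "bimodule_iso f ?T ((power_bimodule n)\<lparr>bcarrier := N\<rparr>)"
    using hsep by (auto simp: h_separable_def)
  have \<epsilon>: "\<epsilon> (x + y) = \<epsilon> x + \<epsilon> y" "\<epsilon> (scale c x) = c * \<epsilon> x" for x y c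
    using counit_linear by (auto simp: functional_iff)
  \<comment> \<open>The map \<open>x \<otimes> y \<mapsto> \<epsilon>(y) x \<Lambda>\<close>; it is balanced over \<open>B\<close> because \<open>\<Lambda>\<close> is an integral of \<open>B\<close>.\<close>
  define \<Phi> where "\<Phi> X = (\<Sum>(x, y) \<in># rep X. scale (\<epsilon> y) (x * \<Lambda>))" for X
  have \<Phi>_class: "\<Phi> (tensor_over B u) = (\<Sum>(x, y) \<in># u. scale (\<epsilon> y) (x * \<Lambda>))" for u
    unfolding \<Phi>_def
    by (rule sum_mset_tensor_eq[symmetric, OF tensor_eq_rep])
      (auto simp: \<epsilon> scale_left_distrib scale_right_distrib distrib_right mult.assoc \<Lambda>
        scale_mult_right counit_mult mult.commute)
  have \<Phi>_add: "\<Phi> (badd ?T X Y) = \<Phi> X + \<Phi> Y" for X Y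
    by (simp add: tensor_bimodule_def \<Phi>_class) (simp add: \<Phi>_def)
  have \<Phi>_left: "\<Phi> (blact ?T c X) = c * \<Phi> X" for c X
    unfolding tensor_bimodule_def
    by (simp add: \<Phi>_class image_mset.compositionality comp_def case_prod_unfold)
      (simp add: \<Phi>_def case_prod_unfold sum_mset_distrib_left scale_mult_right mult.assoc)
  have \<Phi>_right: "\<Phi> (bract ?T X c) = scale (\<epsilon> c) (\<Phi> X)" for c X
    unfolding tensor_bimodule_def
    by (simp add: \<Phi>_class image_mset.compositionality comp_def case_prod_unfold)
      (simp add: \<Phi>_def case_prod_unfold
        lin_sum_mset[OF lin_scale[OF lin_id]] counit_mult mult.commute)
  let ?g = "inv_into (bcarrier ?T) f"
  \<comment> \<open>The same map, transported to the summand \<open>N\<close>.\<close>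
  define \<Psi> where "\<Psi> m = \<Phi> (?g m)" for m
  have bij: "bij_betw f (bcarrier ?T) N" using iso by (simp add: bimodule_iso_def)
  have g: "?g m \<in> bcarrier ?T" "f (?g m) = m" if "m \<in> N" for m
    using bij that by (auto simp: bij_betw_def inv_into_into f_inv_into_f)
  have gf: "?g (f X) = X" if "X \<in> bcarrier ?T" for X
    using bij that by (simp add: bij_betw_def)
  have closed: "badd ?T X Y \<in> bcarrier ?T" "blact ?T c X \<in> bcarrier ?T" "bract ?T X c \<in> bcarrier ?T"
    for X Y c by (simp_all add: tensor_bimodule_def)
  have \<Psi>_add: "\<Psi> (\<lambda>j. m j + m' j) = \<Psi> m + \<Psi> m'" if "m \<in> N" "m' \<in> N" for m m'
  proof -
    have "f (badd ?T (?g m) (?g m')) = (\<lambda>j. m j + m' j)"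
      using iso g[OF that(1)] g[OF that(2)] by (simp add: bimodule_iso_def power_bimodule_def)
    then show ?thesis using gf[OF closed(1), of "?g m" "?g m'"] \<Phi>_add by (simp add: \<Psi>_def)
  qed
  have \<Psi>_left: "\<Psi> (\<lambda>j. c * m j) = c * \<Psi> m" if "m \<in> N" for m c
  proof -
    have "f (blact ?T c (?g m)) = (\<lambda>j. c * m j)"
      using iso g[OF that(1)] by (simp add: bimodule_iso_def power_bimodule_def)
    then show ?thesis using gf[OF closed(2), of c "?g m"] \<Phi>_left by (simp add: \<Psi>_def)
  qed
  have \<Psi>_right: "\<Psi> (\<lambda>j. m j * c) = scale (\<epsilon> c) (\<Psi> m)" if "m \<in> N" for m c
  proof -
    have "f (bract ?T (?g m) c) = (\<lambda>j. m j * c)"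
      using iso g[OF that(1)] by (simp add: bimodule_iso_def power_bimodule_def)
    then show ?thesis using gf[OF closed(3), of "?g m" c] \<Phi>_right by (simp add: \<Psi>_def)
  qed
  let ?one = "tensor_over B {#(1, 1)#}"
  have one_in: "?one \<in> bcarrier ?T" by (simp add: tensor_bimodule_def)
  define r where "r = f ?one"
  have r: "r \<in> N" using bij one_in by (auto simp: r_def bij_betw_def)
  have \<Psi>_r: "\<Psi> r = \<Lambda>" by (simp add: \<Psi>_def r_def gf[OF one_in] \<Phi>_class counit_one)
  from direct_summand_power_generated[OF N r]
  obtain p where p': "\<forall>i<n. p i \<in> N"
    and central: "\<forall>i<n. \<forall>a. (\<lambda>j. a * p i j) = (\<lambda>j. p i j * a)"
    and r_eq: "r = (\<lambda>j. \<Sum>i<n. r i * p i j)"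
    by (elim exE conjE)
  have p: "p i \<in> N" if "i < n" for i using p' that by simp
  have central: "\<Psi> (\<lambda>j. c * p i j) = scale (\<epsilon> c) (\<Psi> (p i))" if "i < n" for i c
  proof -
    have "(\<lambda>j. c * p i j) = (\<lambda>j. p i j * c)" using central that by simp
    then show ?thesis using \<Psi>_right[OF p[OF that]] by simp
  qed
  have sub: "sub_bimodule N (power_bimodule n)" using N by (simp add: direct_summand_def)
  have mult_N: "(\<lambda>j. c * m j) \<in> N" if "m \<in> N" for m c
  proof -
    have "blact (power_bimodule n) c m \<in> N" using sub that by (simp add: sub_bimodule_def)
    then show ?thesis by (simp add: power_bimodule_def)
  qed
  have add_N: "(\<lambda>j. m j + m' j) \<in> N" if "m \<in> N" "m' \<in> N" for m m'
  proof -
    have "badd (power_bimodule n) m m' \<in> N" using sub that by (simp add: sub_bimodule_def)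
    then show ?thesis by (simp add: power_bimodule_def)
  qed
  have sum_\<Psi>: "(\<lambda>j. \<Sum>i<k. r i * p i j) \<in> N \<and>
      \<Psi> (\<lambda>j. \<Sum>i<k. r i * p i j) = (\<Sum>i<k. scale (\<epsilon> (r i)) (\<Psi> (p i)))" if "k \<le> n" for k
    using that
  proof (induction k)
    case 0
    show ?case using mult_N[OF r, of 0] \<Psi>_left[OF r, of 0] by simp
  next
    case (Suc k)
    then have "k < n" by simp
    then have "\<Psi> (\<lambda>j. r k * p k j) = scale (\<epsilon> (r k)) (\<Psi> (p k))"
      by (rule central)
    then show ?case
      using Suc \<Psi>_add add_N mult_N[OF p[OF \<open>k < n\<close>]] by simp
  qed
  have "a * \<Psi> (p i) = scale (\<epsilon> a) (\<Psi> (p i))" if "i < n" for i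
    using \<Psi>_left[OF p[OF that]] central[OF that] by simp
  then have "a * (\<Sum>i<n. scale (\<epsilon> (r i)) (\<Psi> (p i))) = scale (\<epsilon> a) (\<Sum>i<n. scale (\<epsilon> (r i)) (\<Psi> (p i)))"
    by (simp add: sum_distrib_left scale_sum_right scale_mult_right mult.commute)
  moreover have "\<Lambda> = (\<Sum>i<n. scale (\<epsilon> (r i)) (\<Psi> (p i)))"
    using sum_\<Psi>[of n] \<Psi>_r r_eq by simp
  ultimately show ?thesis by simp
qed

end

section \<open>H-separable Hopf subalgebras\<close>

theorem theorem2p2:
  fixes scale :: "'k::field \<Rightarrow> 'a::ring_1 \<Rightarrow> 'a"
    and \<Delta> :: "'a \<Rightarrow> ('a \<times> 'a) multiset set"
    and \<epsilon> :: "'a \<Rightarrow> 'k"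
    and \<tau> :: "'a \<Rightarrow> 'a"
    and B :: "'a set"
  assumes "hopf_algebra scale \<Delta> \<epsilon> \<tau>"
    and "\<exists>X. finite X \<and> module.span scale X = UNIV"
    and "hopf_subalgebra scale \<Delta> \<tau> B"
    and "h_separable B"
  shows "normal_hopf_subalgebra scale \<Delta> \<tau> B"
proof -
  interpret hopf_algebra scale \<Delta> \<epsilon> \<tau> by fact
  obtain X where X: "finite X" "span X = UNIV" using assms(2) by blast
  obtain \<Lambda> where \<Lambda>: "\<Lambda> \<in> B" "\<Lambda> \<noteq> 0" "\<And>b. b \<in> B \<Longrightarrow> b * \<Lambda> = scale (\<epsilon> b) \<Lambda>"
    using integral_exists[OF assms(3) X(1)] X(2) by blast
  have "B = UNIV"
    by (rule hopf_subalgebra_with_integral_full[OF assms(3) X \<Lambda>(1,2)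
          h_separable_integral[OF assms(4) \<Lambda>(3)]])
  then show ?thesis using assms(3) by (simp add: normal_hopf_subalgebra_def)
qed

end
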